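(* Let $p \in (1,\infty)$. Let $\rho_0,\rho_1,\mu_0,\mu_1$ be probability measures on $\mathbb{R}^d$ with finite $p$-th moments. For $i\in\{0,1\}$ let $\gamma_i \in \Pi(\rho_i,\mu_i)$ be an optimal transport plan between $\rho_i$ and $\mu_i$ for the cost $\|x-y\|^p$. Then $$W_p^p(\gamma_0,\gamma_1) \ge c_p\left(W_p^p(\rho_0,\rho_1)+W_p^p(\mu_0,\mu_1)\right),\qquad c_p=\min\left(1,2^{p/2-1}\right).$$
   Context: $\Pi(\rho,\mu)$ is the set of probability measures on $\mathbb{R}^d\times\mathbb{R}^d$ with first marginal $\rho$ and second marginal $\mu$. $W_p(\rho,\mu)=\left(\inf_{\gamma\in\Pi(\rho,\mu)}\int\|x-y\|^p\,\mathrm{d}\gamma\right)^{1/p}$ with the Euclidean norm. $W_p(\gamma_0,\gamma_1)$ is the $p$-Wasserstein distance between probability measures on the product space $\mathbb{R}^d\times\mathbb{R}^d=\mathbb{R}^{2d}$ equipped with its Euclidean norm. *)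

theory Defs
  imports "HOL-Probability.Probability"
begin

definition borel_prob :: "'a::euclidean_space measure \<Rightarrow> bool" where
  "borel_prob M \<longleftrightarrow> prob_space M \<and> sets M = sets borel"

definition finite_moment :: "real \<Rightarrow> 'a::euclidean_space measure \<Rightarrow> bool" where
  "finite_moment p M \<longleftrightarrow> integrable M (\<lambda>x. norm x powr p)"

definition couplings ::
  "'a::euclidean_space measure \<Rightarrow> 'b::euclidean_space measure \<Rightarrow> ('a \<times> 'b) measure set" where
  "couplings \<rho> \<mu> = {\<gamma>. borel_prob \<gamma> \<and> distr \<gamma> borel fst = \<rho> \<and> distr \<gamma> borel snd = \<mu>}"

definition transport_cost :: "real \<Rightarrow> ('a \<times> 'a::euclidean_space) measure \<Rightarrow> ennreal" where
  "transport_cost p \<gamma> = (\<integral>\<^sup>+ (x, y). ennreal (norm (x - y) powr p) \<partial>\<gamma>)"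

definition optimal_plan ::
  "real \<Rightarrow> 'a::euclidean_space measure \<Rightarrow> 'a measure \<Rightarrow> ('a \<times> 'a) measure \<Rightarrow> bool" where
  "optimal_plan p \<rho> \<mu> \<gamma> \<longleftrightarrow>
     \<gamma> \<in> couplings \<rho> \<mu> \<and> (\<forall>\<gamma>' \<in> couplings \<rho> \<mu>. transport_cost p \<gamma> \<le> transport_cost p \<gamma>')"

text \<open>Real powers on \<open>[0, \<infinity>]\<close>, meant for exponents \<open>a > 0\<close>.\<close>

definition ennpowr :: "ennreal \<Rightarrow> real \<Rightarrow> ennreal" where
  "ennpowr x a = (if x = \<infinity> then \<infinity> else ennreal (enn2real x powr a))"

text \<open>
  The distance takes values in \<open>[0, \<infinity>]\<close>, so no integrability is needed for it to be
  meaningful. At the type \<open>'a = 'b \<times> 'b\<close> the norm of the library is the Euclidean product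
  norm, \<open>norm (u, v) = sqrt ((norm u)\<^sup>2 + (norm v)\<^sup>2)\<close>, so this is also the Wasserstein distance
  between transport plans.
\<close>

definition wasserstein :: "real \<Rightarrow> 'a::euclidean_space measure \<Rightarrow> 'a measure \<Rightarrow> ennreal" where
  "wasserstein p \<rho> \<mu> = ennpowr (INF \<gamma> \<in> couplings \<rho> \<mu>. transport_cost p \<gamma>) (1 / p)"

end

theory Submission
  imports Defs
begin

text \<open>
  A coupling of \<open>\<gamma>\<^sub>0\<close> and \<open>\<gamma>\<^sub>1\<close> is a law of \<open>((x\<^sub>0, y\<^sub>0), (x\<^sub>1, y\<^sub>1))\<close>; the laws of \<open>(x\<^sub>0, x\<^sub>1)\<close>
  and \<open>(y\<^sub>0, y\<^sub>1)\<close> couple the first and the second marginals. The claim is then the integral of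
  the pointwise bound of \<open>norm (u, v) powr p\<close> from below, which is superadditivity of
  \<open>t powr (p / 2)\<close> for \<open>p \<ge> 2\<close> and its concavity for \<open>p \<le> 2\<close>.
\<close>

text \<open>Since \<open>q - 1\<close> is nonnegative, replacing one factor
  \<open>x powr (q - 1)\<close> of \<open>x powr q\<close> by the larger
  \<open>s powr (q - 1)\<close>, with \<open>s = a + b\<close>, bounds both powers by linear terms
  whose sum is exactly \<open>s powr q\<close>.\<close>

lemma powr_superadditive:
  fixes a b q :: real
  assumes "0 \<le> a" "0 \<le> b" "1 \<le> q"
  shows "a powr q + b powr q \<le> (a + b) powr q"
proof (cases "a + b = 0")
  case True
  with assms show ?thesis by (simp add: add_nonneg_eq_0_iff)
next
  case False
  define s where "s = a + b"
  have s: "0 < s" using False assms by (simp add: s_def)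
  have bound: "x powr q \<le> x * s powr (q - 1)" if "0 \<le> x" "x \<le> s" for x
  proof -
    have "x powr q = x * x powr (q - 1)"
      using that by (simp add: powr_mult_base)
    also have "\<dots> \<le> x * s powr (q - 1)"
      using that assms by (intro mult_left_mono powr_mono2) auto
    finally show ?thesis .
  qed
  have "a powr q + b powr q \<le> a * s powr (q - 1) + b * s powr (q - 1)"
    using assms by (intro add_mono bound) (auto simp: s_def)
  also have "\<dots> = s * s powr (q - 1)"
    by (simp add: s_def distrib_right)
  also have "\<dots> = s powr q"
    using s by (simp add: powr_mult_base)
  finally show ?thesis by (simp add: s_def)
qed

text \<open>Midpoint concavity: the mean of the powers is at most the power of the mean. Clearing
  the halves leaves the factor \<open>2 powr (q - 1)\<close>, with equality at
  \<open>a = b\<close>.\<close>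

lemma powr_add_le_concave:
  fixes a b q :: real
  assumes "0 \<le> a" "0 \<le> b" "0 < q" "q \<le> 1"
  shows "2 powr (q - 1) * (a powr q + b powr q) \<le> (a + b) powr q"
\<comment> \<open>Convexity is available on the open half-line only. On the boundary a single power
  remains, and the factor is at most 1.\<close>
proof (cases "a = 0 \<or> b = 0")
  case True
  have "2 powr (q - 1) \<le> (1::real)"
    using assms powr_mono[of "q - 1" 0 2] by simp
  then have "2 powr (q - 1) * (a powr q + b powr q) \<le> 1 * (a powr q + b powr q)"
    by (intro mult_right_mono) auto
  then show ?thesis using True by auto
next
  case False
  have "convex_on {0<..} (\<lambda>x::real. x powr (1 / q))"
    using assms by (intro powr_convex) auto
  \<comment> \<open>concavity of \<open>x powr q\<close>, obtained as convexity of its inverse function\<close>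
  from convex_onD[OF this, of "1/2" "a powr q" "b powr q"]
  have "((a powr q + b powr q) / 2) powr (1 / q) \<le> (a + b) / 2"
    using assms False by (simp add: powr_powr add_divide_distrib)
  then have "(((a powr q + b powr q) / 2) powr (1 / q)) powr q \<le> ((a + b) / 2) powr q"
    using assms by (intro powr_mono2) auto
  then have "(a powr q + b powr q) / 2 \<le> (a + b) powr q / 2 powr q"
    using assms by (simp add: powr_powr powr_divide)
  then show ?thesis
    by (simp add: powr_diff field_simps)
qed

text \<open>Apply the two preceding inequalities to the squared norms with exponent
  \<open>p / 2\<close>. The minimum is bounded by 1 when \<open>2 \<le> p\<close> and by its other
  argument when \<open>p < 2\<close>.\<close>

lemma norm_Pair_powr_ge:
  fixes u :: "'a::real_normed_vector" and v :: "'b::real_normed_vector"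
  assumes "0 < p"
  shows "min 1 (2 powr (p / 2 - 1)) * (norm u powr p + norm v powr p) \<le> norm (u, v) powr p"
proof -
  have sq: "(x\<^sup>2) powr (p / 2) = x powr p" if "0 \<le> x" for x :: real
    using that by (simp add: powr_powr flip: powr_numeral)
  have "norm (u, v) powr p = ((norm u)\<^sup>2 + (norm v)\<^sup>2) powr (p / 2)"
    by (simp add: norm_Pair powr_powr flip: powr_half_sqrt)
  moreover have "min 1 (2 powr (p / 2 - 1)) * (norm u powr p + norm v powr p)
      \<le> ((norm u)\<^sup>2 + (norm v)\<^sup>2) powr (p / 2)"
  proof (cases "2 \<le> p")
    case True
    have "min 1 (2 powr (p / 2 - 1)) * (norm u powr p + norm v powr p)
        \<le> 1 * (norm u powr p + norm v powr p)"
      by (intro mult_right_mono) auto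
    then show ?thesis
      using powr_superadditive[of "(norm u)\<^sup>2" "(norm v)\<^sup>2" "p / 2"] True by (simp add: sq)
  next
    case False
    have "min 1 (2 powr (p / 2 - 1)) * (norm u powr p + norm v powr p)
        \<le> 2 powr (p / 2 - 1) * (norm u powr p + norm v powr p)"
      by (intro mult_right_mono) auto
    then show ?thesis
      using powr_add_le_concave[of "(norm u)\<^sup>2" "(norm v)\<^sup>2" "p / 2"] False assms
      by (simp add: sq)
  qed
  ultimately show ?thesis by simp
qed

text \<open>The two powers cancel on all of \<open>ennreal\<close>, including at infinity, so the
  theorem becomes a comparison of infima of costs.\<close>

lemma ennpowr_wasserstein:
  assumes "0 < p"
  shows "ennpowr (wasserstein p \<rho> \<mu>) p = (INF \<gamma>\<in>couplings \<rho> \<mu>. transport_cost p \<gamma>)"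
proof -
  have "ennpowr (ennpowr x (1 / p)) p = x" for x
    using assms by (cases x) (auto simp: ennpowr_def powr_powr)
  then show ?thesis by (simp add: wasserstein_def)
qed

lemma distr_couplings:
  fixes f :: "'a::euclidean_space \<Rightarrow> 'c::euclidean_space"
    and g :: "'b::euclidean_space \<Rightarrow> 'd::euclidean_space"
  assumes \<Gamma>: "\<Gamma> \<in> couplings \<rho> \<mu>"
    and [measurable]: "f \<in> borel_measurable borel" "g \<in> borel_measurable borel"
  shows "distr \<Gamma> borel (map_prod f g) \<in> couplings (distr \<rho> borel f) (distr \<mu> borel g)"
proof -
  from \<Gamma> have "prob_space \<Gamma>" and sets [measurable_cong]: "sets \<Gamma> = sets borel"
    and marg: "distr \<Gamma> borel fst = \<rho>" "distr \<Gamma> borel snd = \<mu>"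
    by (auto simp: couplings_def borel_prob_def)
  then interpret prob_space \<Gamma> by simp
  have [measurable]: "map_prod f g \<in> borel_measurable borel"
    unfolding map_prod_def borel_prod [symmetric] by measurable
  have [measurable]: "map_prod f g \<in> borel_measurable \<Gamma>"
    "fst \<in> borel_measurable \<Gamma>" "snd \<in> borel_measurable \<Gamma>"
    using sets by (simp_all add: measurable_cong_sets[OF sets refl] borel_measurable_continuous_onI
        continuous_on_fst continuous_on_snd continuous_on_id)
  show ?thesis
    \<comment> \<open>With the marginals written as pushforwards of \<open>\<Gamma>\<close>, the
      conditions follow from \<open>fst \<circ> map_prod f g = f \<circ> fst\<close> and its
      analogue for \<open>snd\<close>.\<close>
    unfolding couplings_def borel_prob_def mem_Collect_eq marg [symmetric]
    by (auto intro!: prob_space_distr simp: distr_distr o_def borel_measurable_continuous_onI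
        continuous_on_fst continuous_on_snd continuous_on_id)
qed

text \<open>Change of variables: the costs of both projected couplings become integrals against the
  same \<open>\<Gamma>\<close>, which can be added under one integral sign.\<close>

lemma transport_cost_distr:
  fixes f g :: "'b::euclidean_space \<Rightarrow> 'a::euclidean_space"
  assumes [measurable_cong]: "sets \<Gamma> = sets borel"
    and [measurable]: "f \<in> borel_measurable borel" "g \<in> borel_measurable borel"
  shows "transport_cost p (distr \<Gamma> borel (map_prod f g)) =
    (\<integral>\<^sup>+ z. ennreal (norm (f (fst z) - g (snd z)) powr p) \<partial>\<Gamma>)"
proof -
  have [measurable]: "map_prod f g \<in> borel_measurable borel"
    unfolding map_prod_def borel_prod [symmetric] by measurable
  have "(\<lambda>(x, y). ennreal (norm (x - y :: 'a) powr p)) \<in> borel_measurable (borel \<Otimes>\<^sub>M borel)"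
    by measurable
  then have [measurable]: "(\<lambda>(x, y). ennreal (norm (x - y :: 'a) powr p)) \<in> borel_measurable borel"
    by (simp only: borel_prod)
  show ?thesis
    unfolding transport_cost_def
    by (subst nn_integral_distr) (auto simp: case_prod_beta)
qed

theorem proposition1p3:
  fixes p :: real
    and \<rho>\<^sub>0 \<rho>\<^sub>1 \<mu>\<^sub>0 \<mu>\<^sub>1 :: "(real ^ 'd) measure"
    and \<gamma>\<^sub>0 \<gamma>\<^sub>1 :: "((real ^ 'd) \<times> (real ^ 'd)) measure"
  assumes "1 < p"
    and "borel_prob \<rho>\<^sub>0" and "borel_prob \<rho>\<^sub>1" and "borel_prob \<mu>\<^sub>0" and "borel_prob \<mu>\<^sub>1"
    and "finite_moment p \<rho>\<^sub>0" and "finite_moment p \<rho>\<^sub>1"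
    and "finite_moment p \<mu>\<^sub>0" and "finite_moment p \<mu>\<^sub>1"
    and "optimal_plan p \<rho>\<^sub>0 \<mu>\<^sub>0 \<gamma>\<^sub>0" and "optimal_plan p \<rho>\<^sub>1 \<mu>\<^sub>1 \<gamma>\<^sub>1"
  shows "ennpowr (wasserstein p \<gamma>\<^sub>0 \<gamma>\<^sub>1) p \<ge>
    ennreal (min 1 (2 powr (p / 2 - 1))) *
      (ennpowr (wasserstein p \<rho>\<^sub>0 \<rho>\<^sub>1) p + ennpowr (wasserstein p \<mu>\<^sub>0 \<mu>\<^sub>1) p)"
proof -
  define c where "c = min 1 (2 powr (p / 2 - 1))"
  have c: "0 \<le> c" by (simp add: c_def)
  have p: "0 < p" using assms(1) by simp
  have marg: "distr \<gamma>\<^sub>0 borel fst = \<rho>\<^sub>0" "distr \<gamma>\<^sub>0 borel snd = \<mu>\<^sub>0"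
    "distr \<gamma>\<^sub>1 borel fst = \<rho>\<^sub>1" "distr \<gamma>\<^sub>1 borel snd = \<mu>\<^sub>1"
    using assms(10,11) by (auto simp: optimal_plan_def couplings_def)
  have proj [measurable]: "(fst :: (real ^ 'd) \<times> (real ^ 'd) \<Rightarrow> _) \<in> borel_measurable borel"
    "(snd :: (real ^ 'd) \<times> (real ^ 'd) \<Rightarrow> _) \<in> borel_measurable borel"
    by (simp_all add: borel_measurable_continuous_onI continuous_on_fst continuous_on_snd)
  \<comment> \<open>A lower bound valid for each coupling passes to the infimum.\<close>
  have "ennreal c * ((INF \<gamma>\<in>couplings \<rho>\<^sub>0 \<rho>\<^sub>1. transport_cost p \<gamma>) +
      (INF \<gamma>\<in>couplings \<mu>\<^sub>0 \<mu>\<^sub>1. transport_cost p \<gamma>)) \<le> transport_cost p \<Gamma>"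
    if \<Gamma>: "\<Gamma> \<in> couplings \<gamma>\<^sub>0 \<gamma>\<^sub>1" for \<Gamma>
  proof -
    have sets [measurable_cong]: "sets \<Gamma> = sets borel"
      using \<Gamma> by (simp add: couplings_def borel_prob_def)
    have [measurable]: "fst \<in> measurable \<Gamma> borel" "snd \<in> measurable \<Gamma> borel"
      by (simp_all add: measurable_cong_sets[OF sets refl] borel_measurable_continuous_onI
        continuous_on_fst continuous_on_snd continuous_on_id)
    let ?A = "\<lambda>z. norm (fst (fst z) - fst (snd z)) powr p"
    let ?B = "\<lambda>z. norm (snd (fst z) - snd (snd z)) powr p"
    \<comment> \<open>The law of the two first components under \<open>\<Gamma>\<close> competes in
      this infimum.\<close>
    have "(INF \<gamma>\<in>couplings \<rho>\<^sub>0 \<rho>\<^sub>1. transport_cost p \<gamma>) \<le> (\<integral>\<^sup>+ z. ennreal (?A z) \<partial>\<Gamma>)"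
      using distr_couplings[OF \<Gamma> proj(1) proj(1)]
      by (simp add: INF_lower marg flip: transport_cost_distr[OF sets proj(1) proj(1)])
    moreover have "(INF \<gamma>\<in>couplings \<mu>\<^sub>0 \<mu>\<^sub>1. transport_cost p \<gamma>) \<le> (\<integral>\<^sup>+ z. ennreal (?B z) \<partial>\<Gamma>)"
      using distr_couplings[OF \<Gamma> proj(2) proj(2)]
      by (simp add: INF_lower marg flip: transport_cost_distr[OF sets proj(2) proj(2)])
    ultimately have "ennreal c * ((INF \<gamma>\<in>couplings \<rho>\<^sub>0 \<rho>\<^sub>1. transport_cost p \<gamma>) +
        (INF \<gamma>\<in>couplings \<mu>\<^sub>0 \<mu>\<^sub>1. transport_cost p \<gamma>))
      \<le> ennreal c * ((\<integral>\<^sup>+ z. ennreal (?A z) \<partial>\<Gamma>) + (\<integral>\<^sup>+ z. ennreal (?B z) \<partial>\<Gamma>))"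
      by (intro mult_left_mono add_mono) auto
    also have "\<dots> = (\<integral>\<^sup>+ z. ennreal (c * (?A z + ?B z)) \<partial>\<Gamma>)"
      using c by (simp add: ennreal_mult nn_integral_add nn_integral_cmult)
    \<comment> \<open>The pointwise bound is used at \<open>u = fst (fst z) - fst (snd z)\<close>
      and \<open>v = snd (fst z) - snd (snd z)\<close>, the components of
      \<open>fst z - snd z\<close>.\<close>
    also have "\<dots> \<le> transport_cost p \<Gamma>"
      unfolding transport_cost_def case_prod_beta c_def
      by (intro nn_integral_mono ennreal_leI order_trans[OF norm_Pair_powr_ge[OF p]])
        (simp add: minus_prod_def)
    finally show ?thesis .
  qed
  then show ?thesis
    unfolding ennpowr_wasserstein[OF p] c_def by (intro INF_greatest)
qed

end
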